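(* Let $\{(w_k;y_k;\lambda_k)\}_{k\ge0}$ be generated by the scheme ADMM$_{\rm cf}^{\mu,\alpha,\rho}$. Assume that the sequences $\{w_k\}$ and $\{y_k\}$ are bounded. Suppose that (A1) there is $\bar L\in\mathbb{R}$ with $h(w)+p(y)+\frac\rho2\|w-y\|^2\ge\bar L$ for all $w\in Z_1$, $y\in Z_2$; and (A2) with $\tau>0$, there exist $\nu>0$ and $R>0$ such that $c_1(\nu)>0$, $c_3(\nu)>0$, $c_4(R)>0$, $c_5(R)>0$. Then the sequence $\{\lambda_k\}_{k\ge1}$ is bounded and a subsequence of $\{(w_k;y_k;\lambda_k)\}$ converges to a point $(w^*;y^*;\lambda^* )$ such that $$0\in\partial(h+\mathbf{1}_{Z_1})(w^* )+\lambda^*,\qquad 0\in\partial(p+\mathbf{1}_{Z_2})(y^* )-\lambda^*,\qquad w^*-y^*=\alpha\lambda^*.$$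
   Context: Let $A\in\mathbb{R}^{m\times n}$, $b\in\mathbb{R}^m$, $\gamma>0$, $f_Q(x)=x^TMx+d^Tx$ with $M$ symmetric, $d\in\mathbb{R}^n$, and $g:\mathbb{R}^n\to\mathbb{R}$ smooth convex. Write $w=(x^+;x^-;\xi)$, $y=(y^+;y^-;\zeta)\in\mathbb{R}^{3n}$, and $$h(w)=f_Q(x^+-x^-)+\gamma\sum_{i=1}^n(1-\xi_i),\quad p(y)=g(y^+-y^-),$$ $$Z_1=\{(x^+;x^-;\xi):(x^++x^-)^T\xi=0\},$$ $$Z_2=\{(x^+;x^-;\xi):x^+\ge0,\ x^-\ge0,\ 0\le\xi_i\le1\ \forall i,\ A(x^+-x^-)\ge b\},$$ $$\tilde{\mathcal{L}}_{\rho,\alpha}(w,y,\lambda)=h(w)+p(y)+(1-\rho\alpha)\lambda^T(w-y-\alpha\lambda)+\frac\rho2\|w-y\|^2.$$ Scheme ADMM$_{\rm cf}^{\mu,\alpha,\rho}$: parameters $\alpha,\rho,\mu>0$ with $\rho\alpha\in(0,1)$ and $(\rho+\mu)I+4M\succ0$; initial $w_0,y_0,\lambda_0\in\mathbb{R}^{3n}$; for $k\ge0$ (the stopping test is disregarded, so the sequence is infinite) $$w_{k+1}\in\mathrm{argmin}_{w\in Z_1}\ \tilde{\mathcal{L}}_{\rho,\alpha}(w,y_k,\lambda_k)+\frac\mu2\|w-w_k\|^2,\quad y_{k+1}=\mathrm{argmin}_{y\in Z_2}\ \tilde{\mathcal{L}}_{\rho,\alpha}(w_{k+1},y,\lambda_k),$$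 $$\lambda_{k+1}=(1-\rho\alpha)\lambda_k+\rho(w_{k+1}-y_{k+1}).$$ Constants: $c_1(\nu)=\frac\mu2-\frac{\tau}{2\nu}$, $c_3(\nu)=\tau(\alpha-\frac\nu2)-\frac{(1-\rho\alpha)(2-\rho\alpha)}{2\rho}$, $c_4(R)=\frac{(1-\rho\alpha)[(R+1)\rho\alpha-1]}{2\rho R}$, $c_5(R)=\frac{1-\rho\alpha}{2\rho}[\tau-(1-\rho\alpha)R]$. $\mathbf{1}_Z(z)=0$ if $z\in Z$ and $+\infty$ otherwise. For a proper lower semicontinuous $F$, $\partial F(x)$ is the limiting subdifferential: the set of $v$ for which there exist $x_k\to x$ with $F(x_k)\to F(x)$ and $v_k\to v$ with $v_k$ in the Fréchet subdifferential of $F$ at $x_k$, i.e. $\liminf_{z\to x_k,z\ne x_k}\frac{F(z)-F(x_k)-v_k^T(z-x_k)}{\|z-x_k\|}\ge0$. *)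

theory Defs
  imports "HOL-Analysis.Analysis"
begin

text \<open>
  A point of \<open>R\<^sup>3\<^sup>n\<close> is a triple of vectors of type \<open>real ^ 'n\<close>. The library's inner product and
  norm on products are the Euclidean ones, so \<open>\<bullet>\<close> and \<open>norm\<close> on triples are those of \<open>R\<^sup>3\<^sup>n\<close>.
\<close>

type_synonym 'n triple = "(real ^ 'n) \<times> (real ^ 'n) \<times> (real ^ 'n)"

definition positive_definite :: "real ^ 'n ^ 'n \<Rightarrow> bool" where
  "positive_definite P \<longleftrightarrow> transpose P = P \<and> (\<forall>x. x \<noteq> 0 \<longrightarrow> x \<bullet> (P *v x) > 0)"

text \<open>Smoothness is read as continuous differentiability, so \<open>C\<^sup>\<infinity>\<close> functions are covered.\<close>

definition smooth_fun :: "('a::real_inner \<Rightarrow> real) \<Rightarrow> bool" where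
  "smooth_fun g \<longleftrightarrow> (\<exists>G. (\<forall>x. GDERIV g x :> G x) \<and> continuous_on UNIV G)"

definition f_Q :: "real ^ 'n ^ 'n \<Rightarrow> real ^ 'n \<Rightarrow> real ^ 'n \<Rightarrow> real" where
  "f_Q M d x = x \<bullet> (M *v x) + d \<bullet> x"

definition h_fun :: "real ^ 'n ^ 'n \<Rightarrow> real ^ 'n \<Rightarrow> real \<Rightarrow> 'n triple \<Rightarrow> real" where
  "h_fun M d \<gamma> = (\<lambda>(xp, xm, \<xi>). f_Q M d (xp - xm) + \<gamma> * (\<Sum>i\<in>UNIV. 1 - \<xi> $ i))"

definition p_fun :: "(real ^ 'n \<Rightarrow> real) \<Rightarrow> 'n triple \<Rightarrow> real" where
  "p_fun g = (\<lambda>(yp, ym, \<zeta>). g (yp - ym))"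

definition Z1 :: "'n::finite triple set" where
  "Z1 = {(xp, xm, \<xi>). (xp + xm) \<bullet> \<xi> = 0}"

definition Z2 :: "real ^ 'n ^ 'm \<Rightarrow> real ^ 'm \<Rightarrow> 'n triple set" where
  "Z2 A b = {(xp, xm, \<xi>). (\<forall>i. 0 \<le> xp $ i) \<and> (\<forall>i. 0 \<le> xm $ i) \<and>
     (\<forall>i. 0 \<le> \<xi> $ i \<and> \<xi> $ i \<le> 1) \<and> (\<forall>j. b $ j \<le> (A *v (xp - xm)) $ j)}"

definition lagr :: "('a::real_inner \<Rightarrow> real) \<Rightarrow> ('a \<Rightarrow> real) \<Rightarrow> real \<Rightarrow> real \<Rightarrow> 'a \<Rightarrow> 'a \<Rightarrow> 'a \<Rightarrow> real" where
  "lagr h p \<rho> \<alpha> w y lam = h w + p y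
     + (1 - \<rho> * \<alpha>) * (lam \<bullet> (w - y - \<alpha> *\<^sub>R lam)) + \<rho> / 2 * (norm (w - y))\<^sup>2"

definition admm_cf ::
  "('a::real_inner \<Rightarrow> real) \<Rightarrow> ('a \<Rightarrow> real) \<Rightarrow> 'a set \<Rightarrow> 'a set \<Rightarrow> real \<Rightarrow> real \<Rightarrow> real \<Rightarrow>
   (nat \<Rightarrow> 'a) \<Rightarrow> (nat \<Rightarrow> 'a) \<Rightarrow> (nat \<Rightarrow> 'a) \<Rightarrow> bool" where
  "admm_cf h p S T \<mu> \<alpha> \<rho> w y lam \<longleftrightarrow> (\<forall>k.
     is_arg_min (\<lambda>u. lagr h p \<rho> \<alpha> u (y k) (lam k) + \<mu> / 2 * (norm (u - w k))\<^sup>2)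
       (\<lambda>u. u \<in> S) (w (Suc k)) \<and>
     is_arg_min (\<lambda>v. lagr h p \<rho> \<alpha> (w (Suc k)) v (lam k)) (\<lambda>v. v \<in> T) (y (Suc k)) \<and>
     lam (Suc k) = (1 - \<rho> * \<alpha>) *\<^sub>R lam k + \<rho> *\<^sub>R (w (Suc k) - y (Suc k)))"

definition c1 :: "real \<Rightarrow> real \<Rightarrow> real \<Rightarrow> real" where
  "c1 \<mu> \<tau> \<nu> = \<mu> / 2 - \<tau> / (2 * \<nu>)"

definition c3 :: "real \<Rightarrow> real \<Rightarrow> real \<Rightarrow> real \<Rightarrow> real" where
  "c3 \<rho> \<alpha> \<tau> \<nu> = \<tau> * (\<alpha> - \<nu> / 2) - (1 - \<rho> * \<alpha>) * (2 - \<rho> * \<alpha>) / (2 * \<rho>)"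

definition c4 :: "real \<Rightarrow> real \<Rightarrow> real \<Rightarrow> real" where
  "c4 \<rho> \<alpha> R = (1 - \<rho> * \<alpha>) * ((R + 1) * (\<rho> * \<alpha>) - 1) / (2 * \<rho> * R)"

definition c5 :: "real \<Rightarrow> real \<Rightarrow> real \<Rightarrow> real \<Rightarrow> real" where
  "c5 \<rho> \<alpha> \<tau> R = (1 - \<rho> * \<alpha>) / (2 * \<rho>) * (\<tau> - (1 - \<rho> * \<alpha>) * R)"

definition ind_fun :: "'a set \<Rightarrow> 'a \<Rightarrow> ereal" where
  "ind_fun Z z = (if z \<in> Z then 0 else \<infinity>)"

text \<open>
  Both subdifferentials are empty where the function is not finite. The filter \<open>at x\<close> excludes
  \<open>x\<close> itself.
\<close>

definition frechet_subdiff :: "('a::real_inner \<Rightarrow> ereal) \<Rightarrow> 'a \<Rightarrow> 'a set" where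
  "frechet_subdiff F x = {v. \<bar>F x\<bar> \<noteq> \<infinity> \<and>
     Liminf (at x) (\<lambda>z. (F z - F x - ereal (v \<bullet> (z - x))) / ereal (norm (z - x))) \<ge> 0}"

definition limiting_subdiff :: "('a::real_inner \<Rightarrow> ereal) \<Rightarrow> 'a \<Rightarrow> 'a set" where
  "limiting_subdiff F x = {v. \<bar>F x\<bar> \<noteq> \<infinity> \<and> (\<exists>xs vs.
     xs \<longlonglongrightarrow> x \<and> (\<lambda>k. F (xs k)) \<longlonglongrightarrow> F x \<and> vs \<longlonglongrightarrow> v \<and>
     (\<forall>k. vs k \<in> frechet_subdiff F (xs k)))}"

end

theory Submission
  imports Defs
begin

text \<open>
  The argument is a Lyapunov descent followed by a passage to the limit in the two minimality
  conditions.

  Write \<open>\<Delta>\<^sub>k = \<lambda>\<^sub>k - \<lambda>\<^sub>k\<^sub>-\<^sub>1\<close>. The minimizations over \<open>w\<close> and \<open>y\<close> do not increase the perturbed Lagrangian,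
  and the first gains \<open>\<mu>/2 \<parallel>w\<^sub>k\<^sub>+\<^sub>1 - w\<^sub>k\<parallel>\<^sup>2\<close>. The multiplier update increases it, but, once
  \<open>(1 - \<rho>\<alpha>)\<alpha>/2 \<parallel>\<lambda>\<parallel>\<^sup>2\<close> is added to it, by exactly \<open>(1 - \<rho>\<alpha>)(2 - \<rho>\<alpha>)/(2\<rho>) \<parallel>\<Delta>\<^sub>k\<^sub>+\<^sub>1\<parallel>\<^sup>2\<close>
  (lemma \<open>lagr_multiplier_update\<close>). What pays for this increase is convexity: the optimality condition
  of the \<open>y\<close>-step says that the \<^emph>\<open>new\<close> multiplier \<open>\<lambda>\<^sub>k\<^sub>+\<^sub>1\<close> is a convex subgradient of \<open>p + 1\<^sub>T\<close> at
  \<open>y\<^sub>k\<^sub>+\<^sub>1\<close> (lemma \<open>y_update_subgradient\<close>), so consecutive iterates satisfy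
  \<open>\<Delta>\<^sub>k\<^sub>+\<^sub>1 \<bullet> (y\<^sub>k\<^sub>+\<^sub>1 - y\<^sub>k) \<ge> 0\<close>. Expressing \<open>y\<close> through \<open>w\<close> and \<open>\<lambda>\<close> turns this into a bound of
  \<open>\<parallel>\<Delta>\<^sub>k\<^sub>+\<^sub>1\<parallel>\<^sup>2\<close> by \<open>\<parallel>w\<^sub>k\<^sub>+\<^sub>1 - w\<^sub>k\<parallel>\<^sup>2\<close> and a telescoping difference (lemma
  \<open>multiplier_increment_bound\<close>). Adding \<open>\<tau>\<close> times this bound gives a Lyapunov function that drops in
  each step by at least \<open>c1 \<parallel>w\<^sub>k\<^sub>+\<^sub>1 - w\<^sub>k\<parallel>\<^sup>2 + c3 \<parallel>\<Delta>\<^sub>k\<^sub>+\<^sub>1\<parallel>\<^sup>2\<close> (lemma \<open>lyapunov_descent\<close>).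

  Since \<open>1 - \<rho>\<alpha>\<close> lies in \<open>(0, 1)\<close>, the multiplier recursion is a contraction driven by bounded terms,
  so all iterates stay in a compact set, on which the Lyapunov function is bounded below. Hence the
  increments of \<open>w\<close> and \<open>\<lambda>\<close>, and with them those of \<open>y\<close>, tend to \<open>0\<close>, and along a convergent
  subsequence the shifted iterates have the same limits.

  In the limit, the \<open>w\<close>-step says that \<open>w\<^sup>*\<close> minimizes over \<open>S\<close> the function \<open>h\<close> plus an explicit
  quadratic, and the \<open>y\<close>-step says that \<open>\<lambda>\<^sup>*\<close> is a convex subgradient at \<open>y\<^sup>*\<close>. Both
  are inequalities of proximal type, and these yield limiting subgradients (lemma
  \<open>limiting_subdiffI_proximal\<close>). All of this works for continuous \<open>h\<close> and \<open>p\<close>, closed \<open>S\<close>, and closed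
  convex \<open>T\<close> on which \<open>p\<close> is convex (theorem \<open>admm_cf_subsequence_stationary\<close>).
\<close>

section \<open>Proximal subgradients\<close>

text \<open>
  The hypothesis bounds the difference quotient in the Frechet subdifferential below by
  \<open>- C * norm (z - x)\<close> (it is \<open>\<infinity>\<close> off \<open>Z\<close>), which tends to \<open>0\<close>. So \<open>v\<close> is even a Frechet
  subgradient, and constant sequences witness the limiting one.
\<close>

lemma limiting_subdiffI_proximal:
  fixes f :: "'a::real_inner \<Rightarrow> real"
  assumes "x \<in> Z" and prox: "\<And>z. z \<in> Z \<Longrightarrow> f x + v \<bullet> (z - x) - C * (norm (z - x))\<^sup>2 \<le> f z"
  shows "v \<in> limiting_subdiff (\<lambda>z. ereal (f z) + ind_fun Z z) x"
proof -
  let ?F = "\<lambda>z. ereal (f z) + ind_fun Z z"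
  let ?Q = "\<lambda>z. (?F z - ?F x - ereal (v \<bullet> (z - x))) / ereal (norm (z - x))"
  have Fx: "?F x = ereal (f x)"
    using \<open>x \<in> Z\<close> by (simp add: ind_fun_def)
  have bound: "ereal (- C * norm (z - x)) \<le> ?Q z" if "z \<noteq> x" for z
  proof (cases "z \<in> Z")
    case True
    have "- C * norm (z - x) * norm (z - x) \<le> f z - f x - v \<bullet> (z - x)"
      using prox[OF True] by (simp add: power2_eq_square algebra_simps)
    then have "- C * norm (z - x) \<le> (f z - f x - v \<bullet> (z - x)) / norm (z - x)"
      using that by (simp add: pos_le_divide_eq)
    then show ?thesis
      using True \<open>x \<in> Z\<close> that by (simp add: ind_fun_def)
  next
    case False
    then show ?thesis
      using \<open>x \<in> Z\<close> that by (simp add: ind_fun_def)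
  qed
  have "((\<lambda>z. ereal (- C * norm (z - x))) \<longlongrightarrow> ereal (- C * norm (x - x))) (at x)"
    by (intro tendsto_intros)
  then have lim: "((\<lambda>z. ereal (- C * norm (z - x))) \<longlongrightarrow> 0) (at x)"
    by (simp add: zero_ereal_def)
  have "0 \<le> Liminf (at x) ?Q"
    unfolding le_Liminf_iff
  proof (intro allI impI)
    fix c :: ereal
    assume "c < 0"
    then have "\<forall>\<^sub>F z in at x. c < ereal (- C * norm (z - x))"
      using order_tendstoD(1)[OF lim] by blast
    moreover have "\<forall>\<^sub>F z in at x. z \<noteq> x"
      by (simp add: eventually_at_filter)
    ultimately show "\<forall>\<^sub>F z in at x. c < ?Q z"
      by eventually_elim (use bound less_le_trans in blast)
  qed
  then have "v \<in> frechet_subdiff ?F x"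
    using Fx by (simp add: frechet_subdiff_def)
  then show ?thesis
    unfolding limiting_subdiff_def mem_Collect_eq
    using Fx by (intro conjI exI[of _ "\<lambda>_. x"] exI[of _ "\<lambda>_. v"]) auto
qed

section \<open>The three updates of one iteration\<close>

text \<open>
  The gradient of the smooth part \<open>(1 - \<rho>\<alpha>) lam \<bullet> (w - v) + \<rho>/2 \<parallel>w - v\<parallel>\<^sup>2\<close> at \<open>v = y\<close> is the negative
  of the updated multiplier. Moving from the minimizer \<open>y\<close> a distance \<open>t\<close> towards \<open>v\<close> and letting
  \<open>t \<rightarrow> 0\<close> therefore gives a subgradient inequality for \<open>p\<close> alone.
\<close>

lemma y_update_subgradient:
  fixes w y lam :: "'a::real_inner"
  assumes "convex T" "convex_on T p"
    and y: "is_arg_min (\<lambda>v. lagr h p \<rho> \<alpha> w v lam) (\<lambda>v. v \<in> T) y"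
    and "v \<in> T"
  shows "p y + ((1 - \<rho> * \<alpha>) *\<^sub>R lam + \<rho> *\<^sub>R (w - y)) \<bullet> (v - y) \<le> p v"
proof -
  define s where "s = (1 - \<rho> * \<alpha>) *\<^sub>R lam + \<rho> *\<^sub>R (w - y)"
  define D where "D = p v - p y - s \<bullet> (v - y)"
  have "y \<in> T"
    using y by (simp add: is_arg_min_def)
  have pert: "0 \<le> D + t * (\<rho> / 2 * (norm (v - y))\<^sup>2)" if "0 < t" "t < 1" for t
  proof -
    let ?u = "(1 - t) *\<^sub>R y + t *\<^sub>R v"
    have "?u \<in> T"
      using convexD[OF \<open>convex T\<close> \<open>y \<in> T\<close> \<open>v \<in> T\<close>, of "1 - t" t] that by simp
    then have "lagr h p \<rho> \<alpha> w y lam \<le> lagr h p \<rho> \<alpha> w ?u lam"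
      using y by (force simp: is_arg_min_def not_less)
    moreover have "w - ?u = (w - y) - t *\<^sub>R (v - y)"
      by (simp add: algebra_simps)
    moreover have "p ?u \<le> (1 - t) * p y + t * p v"
      using convex_onD[OF \<open>convex_on T p\<close>, of t y v] \<open>y \<in> T\<close> \<open>v \<in> T\<close> that by simp
    ultimately have "0 \<le> t * (D + t * (\<rho> / 2 * (norm (v - y))\<^sup>2))"
      by (simp add: lagr_def D_def s_def power2_norm_eq_inner inner_simps inner_commute
          algebra_simps)
    then show ?thesis
      using \<open>0 < t\<close> by (simp add: zero_le_mult_iff)
  qed
  have "((\<lambda>t. D + t * (\<rho> / 2 * (norm (v - y))\<^sup>2)) \<longlongrightarrow> D + 0 * (\<rho> / 2 * (norm (v - y))\<^sup>2)) (at_right 0)"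
    by (intro tendsto_intros)
  moreover have "\<forall>\<^sub>F t in at_right 0. 0 \<le> D + t * (\<rho> / 2 * (norm (v - y))\<^sup>2)"
    using pert by (auto simp: eventually_at_right_field intro!: exI[of _ 1])
  ultimately have "0 \<le> D + 0 * (\<rho> / 2 * (norm (v - y))\<^sup>2)"
    by (rule tendsto_lowerbound) simp
  then show ?thesis
    by (simp add: D_def s_def)
qed

text \<open>
  The update can be solved for the residual: \<open>w - y = (lam' - lam)/\<rho> + \<alpha> lam\<close>. After this substitution
  both sides are quadratic forms in \<open>lam\<close> and \<open>lam' - lam\<close>, and the added multiple of
  \<open>\<parallel>lam\<parallel>\<^sup>2\<close> is the one that cancels the mixed term.
\<close>

lemma lagr_multiplier_update:
  fixes w y lam :: "'a::real_inner"
  assumes "\<rho> > 0" and lam': "lam' = (1 - \<rho> * \<alpha>) *\<^sub>R lam + \<rho> *\<^sub>R (w - y)"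
  shows "lagr h p \<rho> \<alpha> w y lam' + (1 - \<rho> * \<alpha>) * \<alpha> / 2 * (norm lam')\<^sup>2 =
    lagr h p \<rho> \<alpha> w y lam + (1 - \<rho> * \<alpha>) * \<alpha> / 2 * (norm lam)\<^sup>2
      + (1 - \<rho> * \<alpha>) * (2 - \<rho> * \<alpha>) / (2 * \<rho>) * (norm (lam' - lam))\<^sup>2"
proof -
  define \<Delta> where "\<Delta> = lam' - lam"
  have "\<rho> *\<^sub>R (w - y) = \<rho> *\<^sub>R ((1 / \<rho>) *\<^sub>R \<Delta> + \<alpha> *\<^sub>R lam)"
    using \<open>\<rho> > 0\<close> by (simp add: \<Delta>_def lam' algebra_simps)
  then have wy: "w - y = (1 / \<rho>) *\<^sub>R \<Delta> + \<alpha> *\<^sub>R lam"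
    using \<open>\<rho> > 0\<close> by simp
  have "lam' = lam + \<Delta>"
    by (simp add: \<Delta>_def)
  then show ?thesis
    unfolding lagr_def wy \<Delta>_def[symmetric]
    using \<open>\<rho> > 0\<close>
    by (simp add: power2_norm_eq_inner inner_simps inner_commute field_simps)
qed

text \<open>
  With \<open>P\<close> and \<open>Q\<close> the new and the old multiplier increment, the two updates give
  \<open>\<rho> (y' - y) = \<rho> (w' - w) - P + (1 - \<rho>\<alpha>) Q\<close>. Insert this into the monotonicity inequality and
  estimate \<open>P \<bullet> (w' - w)\<close> and \<open>P \<bullet> Q\<close> by Young's inequality, with weight \<open>\<nu>\<close> and weight \<open>1\<close>. The terms
  with factor \<open>(1 - \<rho>\<alpha>)/(2\<rho>)\<close> have the same form on both sides, so they telescope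
  along the iteration.
\<close>

lemma multiplier_increment_bound:
  fixes w w' y y' lam0 lam lam' :: "'a::real_inner"
  assumes "\<rho> > 0" "\<nu> > 0" "\<rho> * \<alpha> < 1"
    and lam: "lam = (1 - \<rho> * \<alpha>) *\<^sub>R lam0 + \<rho> *\<^sub>R (w - y)"
    and lam': "lam' = (1 - \<rho> * \<alpha>) *\<^sub>R lam + \<rho> *\<^sub>R (w' - y')"
    and mono: "0 \<le> (lam' - lam) \<bullet> (y' - y)"
  shows "(\<alpha> - \<nu> / 2) * (norm (lam' - lam))\<^sup>2 + (1 - \<rho> * \<alpha>) / (2 * \<rho>) * (norm (lam' - lam))\<^sup>2
    \<le> 1 / (2 * \<nu>) * (norm (w' - w))\<^sup>2 + (1 - \<rho> * \<alpha>) / (2 * \<rho>) * (norm (lam - lam0))\<^sup>2"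
proof -
  define P where "P = lam' - lam"
  define Q where "Q = lam - lam0"
  define W where "W = w' - w"
  define c where "c = (1 - \<rho> * \<alpha>) / (2 * \<rho>)"
  have "c \<ge> 0"
    using assms by (simp add: c_def)
  have "\<rho> *\<^sub>R (y' - y) = \<rho> *\<^sub>R W - P + (1 - \<rho> * \<alpha>) *\<^sub>R Q"
    unfolding W_def P_def Q_def lam' lam by (simp add: algebra_simps)
  then have "\<rho> * (P \<bullet> (y' - y)) = \<rho> * (P \<bullet> W) - P \<bullet> P + (1 - \<rho> * \<alpha>) * (P \<bullet> Q)"
    by (metis inner_add_right inner_diff_right inner_scaleR_right)
  moreover have "0 \<le> \<rho> * (P \<bullet> (y' - y))"
    using mono \<open>\<rho> > 0\<close> by (simp add: P_def)
  ultimately have "P \<bullet> P \<le> \<rho> * (P \<bullet> W) + (1 - \<rho> * \<alpha>) * (P \<bullet> Q)"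
    by linarith
  moreover have "\<rho> * (\<alpha> + 2 * c) = 1" and c2: "\<rho> * 2 * c = 1 - \<rho> * \<alpha>"
    using \<open>\<rho> > 0\<close> by (simp_all add: c_def field_simps)
  then have "\<rho> * ((\<alpha> + 2 * c) * (P \<bullet> P)) = P \<bullet> P"
    by (simp only: mult.assoc[symmetric] mult_1_left)
  moreover have "\<rho> * (P \<bullet> W + 2 * c * (P \<bullet> Q)) = \<rho> * (P \<bullet> W) + (1 - \<rho> * \<alpha>) * (P \<bullet> Q)"
    by (simp only: distrib_left mult.assoc[symmetric] c2)
  ultimately have "\<rho> * ((\<alpha> + 2 * c) * (P \<bullet> P)) \<le> \<rho> * (P \<bullet> W + 2 * c * (P \<bullet> Q))"
    by linarith
  then have *: "(\<alpha> + 2 * c) * (P \<bullet> P) \<le> P \<bullet> W + 2 * c * (P \<bullet> Q)"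
    using \<open>\<rho> > 0\<close> by simp
  have "0 \<le> (1 / (2 * \<nu>)) * (norm (W - \<nu> *\<^sub>R P))\<^sup>2"
    using \<open>\<nu> > 0\<close> by simp
  also have "\<dots> = 1 / (2 * \<nu>) * (W \<bullet> W) + \<nu> / 2 * (P \<bullet> P) - P \<bullet> W"
    using \<open>\<nu> > 0\<close> by (simp add: power2_norm_eq_inner inner_simps inner_commute field_simps)
  finally have young: "P \<bullet> W \<le> 1 / (2 * \<nu>) * (W \<bullet> W) + \<nu> / 2 * (P \<bullet> P)"
    by simp
  have "0 \<le> c * (norm (P - Q))\<^sup>2"
    using \<open>c \<ge> 0\<close> by simp
  also have "\<dots> = c * (P \<bullet> P) + c * (Q \<bullet> Q) - 2 * c * (P \<bullet> Q)"
    by (simp add: power2_norm_eq_inner inner_simps inner_commute algebra_simps)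
  finally have "2 * c * (P \<bullet> Q) \<le> c * (P \<bullet> P) + c * (Q \<bullet> Q)"
    by simp
  with * young show ?thesis
    unfolding P_def[symmetric] Q_def[symmetric] W_def[symmetric] c_def[symmetric]
    by (simp add: power2_norm_eq_inner algebra_simps)
qed

section \<open>Descent of the Lyapunov function\<close>

text \<open>
  The first correction cancels the mixed term of the multiplier update, and the second absorbs the
  telescoping terms of the increment bound; \<open>lam0\<close> is the multiplier preceding \<open>lam\<close>.
\<close>

definition lyapunov ::
  "('a::real_inner \<Rightarrow> real) \<Rightarrow> ('a \<Rightarrow> real) \<Rightarrow> real \<Rightarrow> real \<Rightarrow> real \<Rightarrow> 'a \<Rightarrow> 'a \<Rightarrow> 'a \<Rightarrow> 'a \<Rightarrow> real" where
  "lyapunov h p \<rho> \<alpha> \<tau> w y lam lam0 = lagr h p \<rho> \<alpha> w y lam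
     + (1 - \<rho> * \<alpha>) * \<alpha> / 2 * (norm lam)\<^sup>2
     + \<tau> * ((1 - \<rho> * \<alpha>) / (2 * \<rho>) * (norm (lam - lam0))\<^sup>2)"

lemma admm_cfD:
  assumes "admm_cf h p S T \<mu> \<alpha> \<rho> w y lam"
  shows "is_arg_min (\<lambda>u. lagr h p \<rho> \<alpha> u (y k) (lam k) + \<mu> / 2 * (norm (u - w k))\<^sup>2)
           (\<lambda>u. u \<in> S) (w (Suc k))"
    and "is_arg_min (\<lambda>v. lagr h p \<rho> \<alpha> (w (Suc k)) v (lam k)) (\<lambda>v. v \<in> T) (y (Suc k))"
    and "lam (Suc k) = (1 - \<rho> * \<alpha>) *\<^sub>R lam k + \<rho> *\<^sub>R (w (Suc k) - y (Suc k))"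
    and "w (Suc k) \<in> S" and "y (Suc k) \<in> T"
  using assms by (simp_all add: admm_cf_def is_arg_min_def)

lemma admm_cf_subgradient:
  assumes "admm_cf h p S T \<mu> \<alpha> \<rho> w y lam" "convex T" "convex_on T p" "v \<in> T"
  shows "p (y (Suc k)) + lam (Suc k) \<bullet> (v - y (Suc k)) \<le> p v"
  using y_update_subgradient[OF assms(2,3) admm_cfD(2)[OF assms(1)] assms(4), of k]
  by (simp only: admm_cfD(3)[OF assms(1), of k])

text \<open>
  The index starts at \<open>1\<close>, hence the \<open>Suc\<close> in \<open>V\<close>: the initial points need not lie in \<open>S\<close> and
  \<open>T\<close>, and the subgradient inequality holds only from the first update on.
\<close>

lemma lyapunov_descent:
  assumes scheme: "admm_cf h p S T \<mu> \<alpha> \<rho> w y lam"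
    and "convex T" "convex_on T p"
    and "\<rho> > 0" "\<nu> > 0" "\<tau> > 0" "\<rho> * \<alpha> < 1"
  defines "V \<equiv> \<lambda>k. lyapunov h p \<rho> \<alpha> \<tau> (w (Suc k)) (y (Suc k)) (lam (Suc k)) (lam k)"
  shows "V (Suc k) + c1 \<mu> \<tau> \<nu> * (norm (w (Suc (Suc k)) - w (Suc k)))\<^sup>2
    + c3 \<rho> \<alpha> \<tau> \<nu> * (norm (lam (Suc (Suc k)) - lam (Suc k)))\<^sup>2 \<le> V k"
proof -
  let ?w = "w (Suc k)" and ?w' = "w (Suc (Suc k))"
  let ?y = "y (Suc k)" and ?y' = "y (Suc (Suc k))"
  let ?prev = "lam k" and ?l = "lam (Suc k)" and ?l' = "lam (Suc (Suc k))"
  note D = admm_cfD[OF scheme]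
  have w_step: "lagr h p \<rho> \<alpha> ?w' ?y ?l + \<mu> / 2 * (norm (?w' - ?w))\<^sup>2 \<le> lagr h p \<rho> \<alpha> ?w ?y ?l"
    using D(1)[of "Suc k"] D(4)[of k] by (force simp: is_arg_min_def not_less)
  have y_step: "lagr h p \<rho> \<alpha> ?w' ?y' ?l \<le> lagr h p \<rho> \<alpha> ?w' ?y ?l"
    using D(2)[of "Suc k"] D(5)[of k] by (force simp: is_arg_min_def not_less)
  note lam_step = lagr_multiplier_update[OF \<open>\<rho> > 0\<close> D(3)[of "Suc k"], of h p]
  note sub = admm_cf_subgradient[OF scheme \<open>convex T\<close> \<open>convex_on T p\<close>]
  \<comment> \<open>Monotonicity: add the subgradient inequalities at the two iterates, each tested at the other.\<close>
  have "0 \<le> (?l' - ?l) \<bullet> (?y' - ?y)"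
    using sub[OF D(5)[of "Suc k"], of k] sub[OF D(5)[of k], of "Suc k"]
    by (simp add: inner_simps)
  note bound = multiplier_increment_bound[OF \<open>\<rho> > 0\<close> \<open>\<nu> > 0\<close> \<open>\<rho> * \<alpha> < 1\<close> D(3)[of k] D(3)[of "Suc k"] this]
  have "\<tau> * ((\<alpha> - \<nu> / 2) * (norm (?l' - ?l))\<^sup>2 + (1 - \<rho> * \<alpha>) / (2 * \<rho>) * (norm (?l' - ?l))\<^sup>2)
    \<le> \<tau> * (1 / (2 * \<nu>) * (norm (?w' - ?w))\<^sup>2 + (1 - \<rho> * \<alpha>) / (2 * \<rho>) * (norm (?l - ?prev))\<^sup>2)"
    by (rule mult_left_mono[OF bound less_imp_le[OF \<open>\<tau> > 0\<close>]])
  then have incr: "\<tau> * (\<alpha> - \<nu> / 2) * (norm (?l' - ?l))\<^sup>2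
      + \<tau> * ((1 - \<rho> * \<alpha>) / (2 * \<rho>) * (norm (?l' - ?l))\<^sup>2)
    \<le> \<tau> / (2 * \<nu>) * (norm (?w' - ?w))\<^sup>2 + \<tau> * ((1 - \<rho> * \<alpha>) / (2 * \<rho>) * (norm (?l - ?prev))\<^sup>2)"
    by (simp add: distrib_left mult.assoc)
  show ?thesis
    unfolding V_def lyapunov_def c1_def c3_def
      left_diff_distrib[of "\<mu> / 2"] left_diff_distrib[of "\<tau> * (\<alpha> - \<nu> / 2)"]
    using w_step y_step lam_step incr by linarith
qed

lemma descent_terms_tendsto_0:
  fixes V a b :: "nat \<Rightarrow> real"
  assumes desc: "\<And>k. V (Suc k) + a k + b k \<le> V k"
    and lower: "\<And>k. L \<le> V k" and nonneg: "\<And>k. 0 \<le> a k" "\<And>k. 0 \<le> b k"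
  shows "a \<longlonglongrightarrow> 0" "b \<longlonglongrightarrow> 0"
proof -
  have le: "V (Suc k) \<le> V k" for k
    using desc[of k] nonneg[of k] by linarith
  have "decseq V"
    by (rule decseq_SucI) (rule le)
  then obtain l where "V \<longlonglongrightarrow> l"
    using decseq_convergent[of V L] lower by blast
  then have "(\<lambda>k. V k - V (Suc k)) \<longlonglongrightarrow> l - l"
    by (intro tendsto_diff LIMSEQ_Suc)
  then have lim: "(\<lambda>k. V k - V (Suc k)) \<longlonglongrightarrow> 0"
    by simp
  have "a k \<le> V k - V (Suc k)" "b k \<le> V k - V (Suc k)" for k
    using desc[of k] nonneg[of k] by linarith+
  with nonneg show "a \<longlonglongrightarrow> 0" "b \<longlonglongrightarrow> 0"
    by (auto intro!: tendsto_sandwich[OF _ _ tendsto_const lim])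
qed

lemma tendsto_0_of_scaled_norm_square:
  fixes f :: "nat \<Rightarrow> 'a::real_normed_vector"
  assumes "(\<lambda>k. c * (norm (f k))\<^sup>2) \<longlonglongrightarrow> 0" "c > 0"
  shows "f \<longlonglongrightarrow> 0"
proof -
  have "(\<lambda>k. sqrt (inverse c * (c * (norm (f k))\<^sup>2))) \<longlonglongrightarrow> sqrt (inverse c * 0)"
    by (intro tendsto_intros assms)
  then show ?thesis
    using \<open>c > 0\<close> by (simp add: tendsto_norm_zero_iff mult.assoc[symmetric])
qed

section \<open>Boundedness\<close>

text \<open>
  The ball of radius \<open>B / \<theta>\<close> is invariant when the driving terms are bounded by \<open>B\<close>, because
  \<open>(1 - \<theta>) B / \<theta> + B = B / \<theta>\<close>; the same holds for every larger ball.
\<close>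

lemma bounded_damped_recursion:
  fixes lam e :: "nat \<Rightarrow> 'a::real_normed_vector"
  assumes rec: "\<And>k. lam (Suc k) = (1 - \<theta>) *\<^sub>R lam k + e k"
    and "0 < \<theta>" "\<theta> < 1" and "bounded (range e)"
  shows "bounded (range lam)"
proof -
  obtain B where B: "\<And>k. norm (e k) \<le> B"
    using \<open>bounded (range e)\<close> by (auto simp: bounded_iff)
  let ?K = "max (norm (lam 0)) (B / \<theta>)"
  have "norm (lam k) \<le> ?K" for k
  proof (induction k)
    case (Suc k)
    have "norm (lam (Suc k)) \<le> (1 - \<theta>) * norm (lam k) + norm (e k)"
      using norm_triangle_ineq[of "(1 - \<theta>) *\<^sub>R lam k" "e k"] \<open>\<theta> < 1\<close> by (simp add: rec)
    also have "\<dots> \<le> (1 - \<theta>) * ?K + \<theta> * ?K"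
    proof (intro add_mono mult_left_mono Suc)
      have "B \<le> \<theta> * ?K"
        using \<open>0 < \<theta>\<close> by (metis max.cobounded2 mult.commute pos_divide_le_eq)
      then show "norm (e k) \<le> \<theta> * ?K"
        using B[of k] by linarith
    qed (use \<open>\<theta> < 1\<close> in simp)
    finally show ?case
      by (simp add: algebra_simps)
  qed simp
  then show ?thesis
    by (auto simp: bounded_iff)
qed

lemma continuous_on_lagr:
  fixes h p :: "'a::euclidean_space \<Rightarrow> real"
  assumes "continuous_on UNIV h" "continuous_on UNIV p"
  shows "continuous_on UNIV (\<lambda>(u, v, l). lagr h p \<rho> \<alpha> u v l)"
proof -
  have "continuous_on UNIV (\<lambda>z :: 'a \<times> 'a \<times> 'a. h (fst z))"
    by (rule continuous_on_compose2[OF assms(1)]) (intro continuous_intros subset_UNIV)+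
  moreover have "continuous_on UNIV (\<lambda>z :: 'a \<times> 'a \<times> 'a. p (fst (snd z)))"
    by (rule continuous_on_compose2[OF assms(2)]) (intro continuous_intros subset_UNIV)+
  ultimately show ?thesis
    unfolding lagr_def case_prod_beta by (intro continuous_intros)
qed

lemma lagr_bounded_below:
  fixes h p :: "'a::euclidean_space \<Rightarrow> real" and w y lam :: "nat \<Rightarrow> 'a"
  assumes "continuous_on UNIV h" "continuous_on UNIV p"
    and "bounded (range w)" "bounded (range y)" "bounded (range lam)"
  shows "\<exists>L. \<forall>k. L \<le> lagr h p \<rho> \<alpha> (w k) (y k) (lam k)"
proof -
  let ?f = "\<lambda>(u, v, l). lagr h p \<rho> \<alpha> u v l"
  let ?K = "closure (range w \<times> range y \<times> range lam)"
  have "compact ?K"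
    using assms by (simp add: bounded_Times)
  then have "compact (?f ` ?K)"
    by (intro compact_continuous_image continuous_on_subset[OF continuous_on_lagr[OF assms(1,2)]]) auto
  then obtain B where B: "\<And>x. x \<in> ?f ` ?K \<Longrightarrow> norm x \<le> B"
    by (metis bounded_iff compact_imp_bounded)
  have "- B \<le> lagr h p \<rho> \<alpha> (w k) (y k) (lam k)" for k
  proof -
    have "(w k, y k, lam k) \<in> ?K"
      using closure_subset[of "range w \<times> range y \<times> range lam"] by auto
    from B[OF imageI[OF this]] show ?thesis
      by simp
  qed
  then show ?thesis
    by blast
qed

section \<open>Subsequential limits are stationary\<close>

lemma admm_cf_asymptotically_regular:
  fixes w y lam :: "nat \<Rightarrow> 'a::euclidean_space"
  assumes scheme: "admm_cf h p S T \<mu> \<alpha> \<rho> w y lam"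
    and "convex T" "convex_on T p" "continuous_on UNIV h" "continuous_on UNIV p"
    and "\<alpha> > 0" "\<rho> > 0" "\<tau> > 0" "\<nu> > 0" "\<rho> * \<alpha> < 1"
    and "c1 \<mu> \<tau> \<nu> > 0" "c3 \<rho> \<alpha> \<tau> \<nu> > 0"
    and "bounded (range w)" "bounded (range y)" "bounded (range lam)"
  shows "(\<lambda>k. w (Suc k) - w k) \<longlonglongrightarrow> 0" "(\<lambda>k. lam (Suc k) - lam k) \<longlonglongrightarrow> 0"
proof -
  let ?V = "\<lambda>k. lyapunov h p \<rho> \<alpha> \<tau> (w (Suc k)) (y (Suc k)) (lam (Suc k)) (lam k)"
  obtain L where "\<And>k. L \<le> lagr h p \<rho> \<alpha> (w k) (y k) (lam k)"
    using lagr_bounded_below[OF assms(4,5,13-15)] by blast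
  moreover have "lagr h p \<rho> \<alpha> (w (Suc k)) (y (Suc k)) (lam (Suc k)) \<le> ?V k" for k
    using assms by (simp add: lyapunov_def)
  ultimately have lower: "L \<le> ?V k" for k
    using order_trans by blast
  note lim = descent_terms_tendsto_0[of ?V,
      OF lyapunov_descent[OF scheme assms(2,3) \<open>\<rho> > 0\<close> \<open>\<nu> > 0\<close> \<open>\<tau> > 0\<close> \<open>\<rho> * \<alpha> < 1\<close>] lower]
  have "(\<lambda>k. w (Suc (Suc k)) - w (Suc k)) \<longlonglongrightarrow> 0"
    by (rule tendsto_0_of_scaled_norm_square[OF lim(1)]) (use assms in auto)
  then show "(\<lambda>k. w (Suc k) - w k) \<longlonglongrightarrow> 0"
    by (rule LIMSEQ_imp_Suc)
  have "(\<lambda>k. lam (Suc (Suc k)) - lam (Suc k)) \<longlonglongrightarrow> 0"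
    by (rule tendsto_0_of_scaled_norm_square[OF lim(2)]) (use assms in auto)
  then show "(\<lambda>k. lam (Suc k) - lam k) \<longlonglongrightarrow> 0"
    by (rule LIMSEQ_imp_Suc)
qed

text \<open>
  The increments of \<open>w\<close> and \<open>lam\<close> vanish asymptotically, so the data \<open>w k\<close>, \<open>y k\<close>, \<open>lam k\<close> of an
  iteration and its results have common limits along a subsequence. The minimality conditions are
  closed under such limits by continuity of \<open>h\<close> and \<open>p\<close>.
\<close>

theorem admm_cf_subsequence_stationary:
  fixes w y lam :: "nat \<Rightarrow> 'a::euclidean_space"
  assumes scheme: "admm_cf h p S T \<mu> \<alpha> \<rho> w y lam"
    and "closed S" "closed T" "convex T" "convex_on T p"
    and cont: "continuous_on UNIV h" "continuous_on UNIV p"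
    and "\<alpha> > 0" "\<rho> > 0" "\<tau> > 0" "\<nu> > 0" "\<rho> * \<alpha> < 1"
    and "c1 \<mu> \<tau> \<nu> > 0" "c3 \<rho> \<alpha> \<tau> \<nu> > 0"
    and bdd: "bounded (range w)" "bounded (range y)"
  shows "bounded (range lam) \<and>
    (\<exists>r ws ys ls. strict_mono (r :: nat \<Rightarrow> nat) \<and>
       (\<lambda>j. (w (r j), y (r j), lam (r j))) \<longlonglongrightarrow> (ws, ys, ls) \<and>
       - ls \<in> limiting_subdiff (\<lambda>u. ereal (h u) + ind_fun S u) ws \<and>
       ls \<in> limiting_subdiff (\<lambda>u. ereal (p u) + ind_fun T u) ys \<and>
       ws - ys = \<alpha> *\<^sub>R ls)"
proof
  note D = admm_cfD[OF scheme]
  have "bounded (range (\<lambda>k. w k - y k))"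
    using bdd by (rule bounded_minus_comp)
  then have "bounded (range (\<lambda>k. w (Suc k) - y (Suc k)))"
    by (rule bounded_subset) auto
  then have "bounded (range (\<lambda>k. \<rho> *\<^sub>R (w (Suc k) - y (Suc k))))"
    by (rule bounded_scaleR_comp)
  then show bdd_lam: "bounded (range lam)"
    by (intro bounded_damped_recursion[of lam "\<rho> * \<alpha>", OF D(3)]) (use assms in auto)
  note regular = admm_cf_asymptotically_regular[OF scheme assms(4-14) bdd bdd_lam]

  have "bounded (range (\<lambda>k. (w k, y k, lam k)))"
    by (rule bounded_subset[OF bounded_Times[OF bdd(1) bounded_Times[OF bdd(2) bdd_lam]]]) auto
  then obtain z r where r: "strict_mono (r :: nat \<Rightarrow> nat)"
    and z: "((\<lambda>k. (w k, y k, lam k)) \<circ> r) \<longlonglongrightarrow> z"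
    using bounded_imp_convergent_subsequence by blast
  obtain ws ys ls where zz: "z = (ws, ys, ls)"
    by (cases z)
  have trip: "(\<lambda>j. (w (r j), y (r j), lam (r j))) \<longlonglongrightarrow> (ws, ys, ls)"
    using z by (simp add: zz o_def)
  have w_lim: "(\<lambda>j. w (r j)) \<longlonglongrightarrow> ws"
    using tendsto_fst[OF trip] by simp
  have y_lim: "(\<lambda>j. y (r j)) \<longlonglongrightarrow> ys"
    using tendsto_fst[OF tendsto_snd[OF trip]] by simp
  have lam_lim: "(\<lambda>j. lam (r j)) \<longlonglongrightarrow> ls"
    using tendsto_snd[OF tendsto_snd[OF trip]] by simp
  have w_lim': "(\<lambda>j. w (Suc (r j))) \<longlonglongrightarrow> ws"
    using tendsto_add[OF LIMSEQ_subseq_LIMSEQ[OF regular(1) r] w_lim] by (simp add: o_def)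
  have lam_lim': "(\<lambda>j. lam (Suc (r j))) \<longlonglongrightarrow> ls"
    using tendsto_add[OF LIMSEQ_subseq_LIMSEQ[OF regular(2) r] lam_lim] by (simp add: o_def)
  \<comment> \<open>The multiplier update solved for \<open>y\<close>; limits and increments of \<open>y\<close> follow from those of \<open>w\<close>
    and \<open>lam\<close>.\<close>
  have y_eq: "y (Suc k) = w (Suc k) - (1 / \<rho>) *\<^sub>R (lam (Suc k) - lam k) - \<alpha> *\<^sub>R lam k" for k
    using \<open>\<rho> > 0\<close> by (simp add: D(3) algebra_simps)
  have y_lim': "(\<lambda>j. y (Suc (r j))) \<longlonglongrightarrow> ws - \<alpha> *\<^sub>R ls"
  proof -
    have "(\<lambda>j. y (Suc (r j))) \<longlonglongrightarrow> ws - (1 / \<rho>) *\<^sub>R (ls - ls) - \<alpha> *\<^sub>R ls"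
      unfolding y_eq by (intro tendsto_intros w_lim' lam_lim lam_lim')
    then show ?thesis
      by simp
  qed
  have ys: "ys = ws - \<alpha> *\<^sub>R ls"
  proof -
    have "(\<lambda>k. y (Suc (Suc k)) - y (Suc k)) \<longlonglongrightarrow> 0 - (1 / \<rho>) *\<^sub>R (0 - 0) - \<alpha> *\<^sub>R 0"
    proof -
      have "y (Suc (Suc k)) - y (Suc k) = (w (Suc (Suc k)) - w (Suc k))
          - (1 / \<rho>) *\<^sub>R ((lam (Suc (Suc k)) - lam (Suc k)) - (lam (Suc k) - lam k))
          - \<alpha> *\<^sub>R (lam (Suc k) - lam k)" for k
        unfolding y_eq by (simp add: algebra_simps)
      then show ?thesis
        by (simp only:) (intro tendsto_intros regular LIMSEQ_Suc[OF regular(1)] LIMSEQ_Suc[OF regular(2)])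
    qed
    then have "(\<lambda>k. y (Suc (Suc k)) - y (Suc k)) \<longlonglongrightarrow> 0"
      by simp
    then have "(\<lambda>k. y (Suc k) - y k) \<longlonglongrightarrow> 0"
      by (rule LIMSEQ_imp_Suc)
    from tendsto_add[OF LIMSEQ_subseq_LIMSEQ[OF this r] y_lim]
    have "(\<lambda>j. y (Suc (r j))) \<longlonglongrightarrow> ys"
      by (simp add: o_def)
    with y_lim' show ?thesis
      using LIMSEQ_unique by blast
  qed
  note y_lim'' = y_lim'[folded ys]
  have cont_lim: "(\<lambda>j. f (x j)) \<longlonglongrightarrow> f l" if "continuous_on UNIV f" "x \<longlonglongrightarrow> l"
    for f :: "'a \<Rightarrow> real" and x l
    using continuous_on_tendsto_compose[OF that] by simp

  have "ws \<in> S"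
    using closed_sequentially[OF \<open>closed S\<close> _ w_lim'] D(4) by blast
  have "ys \<in> T"
    using closed_sequentially[OF \<open>closed T\<close> _ y_lim''] D(5) by blast

  have p_sub: "p ys + ls \<bullet> (v - ys) \<le> p v" if "v \<in> T" for v
  proof (rule LIMSEQ_le_const2)
    show "(\<lambda>j. p (y (Suc (r j))) + lam (Suc (r j)) \<bullet> (v - y (Suc (r j)))) \<longlonglongrightarrow> p ys + ls \<bullet> (v - ys)"
      by (intro tendsto_intros cont_lim[OF cont(2)] y_lim'' lam_lim')
    show "\<exists>N. \<forall>n\<ge>N. p (y (Suc (r n))) + lam (Suc (r n)) \<bullet> (v - y (Suc (r n))) \<le> p v"
      using admm_cf_subgradient[OF scheme \<open>convex T\<close> \<open>convex_on T p\<close> that] by blast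
  qed
  have p_in: "ls \<in> limiting_subdiff (\<lambda>u. ereal (p u) + ind_fun T u) ys"
    by (rule limiting_subdiffI_proximal[where C = 0]) (use p_sub \<open>ys \<in> T\<close> in auto)

  \<comment> \<open>The limit of the \<open>w\<close>-step: \<open>ws\<close> minimizes \<open>h\<close> plus a quadratic with Hessian \<open>\<rho> + \<mu>\<close>, whose gradient
    at \<open>ws\<close> is \<open>(1 - \<rho>\<alpha>) ls + \<rho> (ws - ys) = ls\<close>.\<close>
  have h_sub: "h ws + (- ls) \<bullet> (u - ws) - (\<rho> + \<mu>) / 2 * (norm (u - ws))\<^sup>2 \<le> h u" if "u \<in> S" for u
  proof -
    have lagr_lim: "(\<lambda>j. lagr h p \<rho> \<alpha> (x j) (y (r j)) (lam (r j))) \<longlonglongrightarrow> lagr h p \<rho> \<alpha> l ys ls"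
      if "x \<longlonglongrightarrow> l" for x l
      unfolding lagr_def
      by (intro tendsto_intros cont_lim[OF cont(1)] cont_lim[OF cont(2)] that y_lim lam_lim)
    have "lagr h p \<rho> \<alpha> ws ys ls + \<mu> / 2 * (norm (ws - ws))\<^sup>2
      \<le> lagr h p \<rho> \<alpha> u ys ls + \<mu> / 2 * (norm (u - ws))\<^sup>2"
    proof (rule LIMSEQ_le)
      show "(\<lambda>j. lagr h p \<rho> \<alpha> (w (Suc (r j))) (y (r j)) (lam (r j))
          + \<mu> / 2 * (norm (w (Suc (r j)) - w (r j)))\<^sup>2)
        \<longlonglongrightarrow> lagr h p \<rho> \<alpha> ws ys ls + \<mu> / 2 * (norm (ws - ws))\<^sup>2"
        by (intro tendsto_intros lagr_lim w_lim w_lim')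
      show "(\<lambda>j. lagr h p \<rho> \<alpha> u (y (r j)) (lam (r j)) + \<mu> / 2 * (norm (u - w (r j)))\<^sup>2)
        \<longlonglongrightarrow> lagr h p \<rho> \<alpha> u ys ls + \<mu> / 2 * (norm (u - ws))\<^sup>2"
        by (intro tendsto_intros lagr_lim w_lim)
      show "\<exists>N. \<forall>n\<ge>N. lagr h p \<rho> \<alpha> (w (Suc (r n))) (y (r n)) (lam (r n))
          + \<mu> / 2 * (norm (w (Suc (r n)) - w (r n)))\<^sup>2
        \<le> lagr h p \<rho> \<alpha> u (y (r n)) (lam (r n)) + \<mu> / 2 * (norm (u - w (r n)))\<^sup>2"
        using D(1) that by (force simp: is_arg_min_def not_less)
    qed
    moreover define e where "e = u - ws"
    moreover have "ws - ys = \<alpha> *\<^sub>R ls" and "u - ys = e + \<alpha> *\<^sub>R ls"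
      by (simp_all add: ys e_def)
    ultimately have "h ws + \<rho> / 2 * (norm (\<alpha> *\<^sub>R ls))\<^sup>2 \<le> h u + (1 - \<rho> * \<alpha>) * (ls \<bullet> e)
        + \<rho> / 2 * (norm (e + \<alpha> *\<^sub>R ls))\<^sup>2 + \<mu> / 2 * (norm e)\<^sup>2"
      by (simp add: lagr_def)
    then show ?thesis
      unfolding e_def[symmetric]
      by (simp add: power2_norm_eq_inner inner_simps inner_commute power2_eq_square[of \<alpha>]
          add_divide_distrib algebra_simps)
  qed
  have h_in: "- ls \<in> limiting_subdiff (\<lambda>u. ereal (h u) + ind_fun S u) ws"
    by (rule limiting_subdiffI_proximal[OF \<open>ws \<in> S\<close> h_sub])

  show "\<exists>r ws ys ls. strict_mono (r :: nat \<Rightarrow> nat) \<and>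
       (\<lambda>j. (w (r j), y (r j), lam (r j))) \<longlonglongrightarrow> (ws, ys, ls) \<and>
       - ls \<in> limiting_subdiff (\<lambda>u. ereal (h u) + ind_fun S u) ws \<and>
       ls \<in> limiting_subdiff (\<lambda>u. ereal (p u) + ind_fun T u) ys \<and>
       ws - ys = \<alpha> *\<^sub>R ls"
    using r trip h_in p_in ys by (intro exI[of _ r] exI[of _ ws] exI[of _ ys] exI[of _ ls]) simp
qed

section \<open>The quadratic problem with a complementarity constraint\<close>

lemma continuous_on_h_fun:
  fixes M :: "real ^ 'n ^ 'n"
  shows "continuous_on UNIV (h_fun M d \<gamma>)"
proof -
  have "continuous_on UNIV (\<lambda>z :: 'n triple. M *v (fst z - fst (snd z)))"
    by (intro bounded_linear.continuous_on[OF matrix_vector_mul_bounded_linear] continuous_intros)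
  then show ?thesis
    unfolding h_fun_def f_Q_def case_prod_beta by (intro continuous_intros)
qed

lemma continuous_on_p_fun:
  assumes "smooth_fun g"
  shows "continuous_on UNIV (p_fun g)"
proof -
  have "continuous_on UNIV g"
    using assms by (metis gderiv_def has_derivative_continuous continuous_at_imp_continuous_on
        smooth_fun_def)
  then show ?thesis
    unfolding p_fun_def case_prod_beta
    by (rule continuous_on_compose2) (intro continuous_intros subset_UNIV)+
qed

lemma convex_on_p_fun:
  assumes "convex_on UNIV g" "convex T"
  shows "convex_on T (p_fun g)"
proof (rule convex_onI)
  fix t :: real and u v :: "'a triple"
  assume t: "0 < t" "t < 1"
  obtain up um uz vp vm vz where uv: "u = (up, um, uz)" "v = (vp, vm, vz)"
    by (metis prod_cases3)
  have "p_fun g ((1 - t) *\<^sub>R u + t *\<^sub>R v) = g ((1 - t) *\<^sub>R (up - um) + t *\<^sub>R (vp - vm))"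
    by (simp add: p_fun_def uv algebra_simps)
  also have "\<dots> \<le> (1 - t) * g (up - um) + t * g (vp - vm)"
    using convex_onD[OF assms(1)] t by simp
  finally show "p_fun g ((1 - t) *\<^sub>R u + t *\<^sub>R v) \<le> (1 - t) * p_fun g u + t * p_fun g v"
    by (simp add: p_fun_def uv)
qed (fact assms(2))

lemma closed_Z1: "closed (Z1 :: 'n::finite triple set)"
proof -
  have "Z1 = {z :: 'n triple. (fst z + fst (snd z)) \<bullet> snd (snd z) = 0}"
    by (auto simp: Z1_def)
  moreover have "closed {z :: 'n triple. (fst z + fst (snd z)) \<bullet> snd (snd z) = 0}"
    by (intro closed_Collect_eq continuous_intros)
  ultimately show ?thesis
    by simp
qed

lemma closed_Z2: "closed (Z2 A b)"
proof -
  have "Z2 A b = {z. (\<forall>i. 0 \<le> fst z $ i) \<and> (\<forall>i. 0 \<le> fst (snd z) $ i) \<and>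
     (\<forall>i. 0 \<le> snd (snd z) $ i \<and> snd (snd z) $ i \<le> 1) \<and>
     (\<forall>j. b $ j \<le> (A *v (fst z - fst (snd z))) $ j)}"
    by (auto simp: Z2_def)
  then show ?thesis
    by (simp only:) (intro closed_Collect_conj closed_Collect_all closed_Collect_le
      continuous_intros bounded_linear.continuous_on[OF matrix_vector_mul_bounded_linear])
qed

lemma convex_Z2:
  fixes A :: "real ^ 'n ^ 'm"
  shows "convex (Z2 A b)"
proof -
  have mix: "c \<le> s * a + t * e" if "c \<le> a" "c \<le> e" "0 \<le> s" "0 \<le> t" "s + t = 1" for c a e s t :: real
    using that convex_bound_le[of "-a" "-c" "-e" s t] by simp
  show ?thesis
    unfolding convex_def
  proof (intro ballI allI impI)
    fix u v :: "'n triple" and s t :: real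
    assume st: "0 \<le> s" "0 \<le> t" "s + t = 1" and uv: "u \<in> Z2 A b" "v \<in> Z2 A b"
    obtain up um uz vp vm vz where [simp]: "u = (up, um, uz)" "v = (vp, vm, vz)"
      by (metis prod_cases3)
    have "s *\<^sub>R up + t *\<^sub>R vp - (s *\<^sub>R um + t *\<^sub>R vm) = s *\<^sub>R (up - um) + t *\<^sub>R (vp - vm)"
      by (simp add: algebra_simps)
    then have "A *v (s *\<^sub>R up + t *\<^sub>R vp - (s *\<^sub>R um + t *\<^sub>R vm))
      = s *\<^sub>R (A *v (up - um)) + t *\<^sub>R (A *v (vp - vm))"
      by (simp add: matrix_vector_right_distrib matrix_vector_mult_scaleR)
    with uv st show "s *\<^sub>R u + t *\<^sub>R v \<in> Z2 A b"
      by (auto simp: Z2_def intro!: mix convex_bound_le)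
  qed
qed

theorem theorem2:
  fixes A :: "real ^ 'n ^ 'm" and b :: "real ^ 'm"
    and M :: "real ^ 'n ^ 'n" and d :: "real ^ 'n"
    and g :: "real ^ 'n \<Rightarrow> real"
    and \<gamma> \<alpha> \<rho> \<mu> \<tau> :: real
    and w y lam :: "nat \<Rightarrow> 'n triple"
  assumes "\<gamma> > 0" and "transpose M = M"
    and "smooth_fun g" and "convex_on UNIV g"
    and "\<alpha> > 0" and "\<rho> > 0" and "\<mu> > 0" and "0 < \<rho> * \<alpha>" and "\<rho> * \<alpha> < 1"
    and "positive_definite ((\<rho> + \<mu>) *\<^sub>R mat 1 + 4 *\<^sub>R M)"
    and scheme: "admm_cf (h_fun M d \<gamma>) (p_fun g) Z1 (Z2 A b) \<mu> \<alpha> \<rho> w y lam"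
    and "bounded (range w)" and "bounded (range y)"
    and A1: "\<exists>L::real. \<forall>u\<in>Z1. \<forall>v\<in>Z2 A b.
               h_fun M d \<gamma> u + p_fun g v + \<rho> / 2 * (norm (u - v))\<^sup>2 \<ge> L"
    and "\<tau> > 0"
    and A2: "\<exists>\<nu> R. \<nu> > 0 \<and> R > 0 \<and> c1 \<mu> \<tau> \<nu> > 0 \<and> c3 \<rho> \<alpha> \<tau> \<nu> > 0 \<and>
               c4 \<rho> \<alpha> R > 0 \<and> c5 \<rho> \<alpha> \<tau> R > 0"
  shows "bounded (lam ` {1..}) \<and>
    (\<exists>r ws ys ls. strict_mono (r :: nat \<Rightarrow> nat) \<and>
       (\<lambda>j. (w (r j), y (r j), lam (r j))) \<longlonglongrightarrow> (ws, ys, ls) \<and>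
       0 \<in> (\<lambda>v. v + ls) ` limiting_subdiff (\<lambda>u. ereal (h_fun M d \<gamma> u) + ind_fun Z1 u) ws \<and>
       0 \<in> (\<lambda>v. v - ls) ` limiting_subdiff (\<lambda>u. ereal (p_fun g u) + ind_fun (Z2 A b) u) ys \<and>
       ws - ys = \<alpha> *\<^sub>R ls)"
proof -
  obtain \<nu> where \<nu>: "\<nu> > 0" "c1 \<mu> \<tau> \<nu> > 0" "c3 \<rho> \<alpha> \<tau> \<nu> > 0"
    using A2 by blast
  from admm_cf_subsequence_stationary[OF scheme closed_Z1 closed_Z2 convex_Z2
      convex_on_p_fun[OF \<open>convex_on UNIV g\<close> convex_Z2] continuous_on_h_fun
      continuous_on_p_fun[OF \<open>smooth_fun g\<close>] \<open>\<alpha> > 0\<close> \<open>\<rho> > 0\<close> \<open>\<tau> > 0\<close> \<nu>(1) \<open>\<rho> * \<alpha> < 1\<close> \<nu>(2,3)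
      \<open>bounded (range w)\<close> \<open>bounded (range y)\<close>]
  obtain r ws ys ls where "bounded (range lam)" "strict_mono (r :: nat \<Rightarrow> nat)"
    "(\<lambda>j. (w (r j), y (r j), lam (r j))) \<longlonglongrightarrow> (ws, ys, ls)"
    "- ls \<in> limiting_subdiff (\<lambda>u. ereal (h_fun M d \<gamma> u) + ind_fun Z1 u) ws"
    "ls \<in> limiting_subdiff (\<lambda>u. ereal (p_fun g u) + ind_fun (Z2 A b) u) ys"
    "ws - ys = \<alpha> *\<^sub>R ls"
    by blast
  moreover from this(1) have "bounded (lam ` {1..})"
    by (rule bounded_subset) auto
  ultimately show ?thesis
    by (intro conjI exI[of _ r] exI[of _ ws] exI[of _ ys] exI[of _ ls]) (auto intro: rev_image_eqI)
qed

end
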